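(* For every integer $n\ge 3$ there is a graph $G$ of order $n$ with $c(G)\ge \lfloor n^2/4\rfloor+1$.
   Context: Graphs are finite, simple and undirected; the order of a graph is its number of vertices. The acyclic orientation game on a graph $G$ (known to both players) is played by Algy and Strategist. At each step Algy selects any edge of $G$ and Strategist has to orient this edge; the only restriction on Strategist's replies is that the revealed partial orientation must be acyclic, that is, it contains no directed cycles. The game ends when the current partial orientation extends to a unique acyclic orientation of the whole graph $G$. Algy tries to minimize the number of steps, Strategist tries to maximize it. The parameter $c(G)$ is the length of the game (number of steps, i.e. edges queried) when both players play optimally. Equivalently, $c(G)$ is the smallest number such that Algy has an adaptive edge-querying strategy that determines a hidden acyclic orientation of $G$ using at most $c(G)$ queries, for every acyclic orientation of $G$. *)

theory Defs
  imports Main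
begin

definition simple_graph :: "'a set \<Rightarrow> 'a set set \<Rightarrow> bool" where
  "simple_graph V E \<longleftrightarrow> finite V \<and> (\<forall>e\<in>E. e \<subseteq> V \<and> card e = 2)"

text \<open>
  An orientation is the set of its arcs, \<open>(u, v)\<close> meaning that the edge \<open>{u, v}\<close> points
  from \<open>u\<close> to \<open>v\<close>.  Acyclicity excludes the 2-cycle \<open>(u, v), (v, u)\<close>, so no edge is
  oriented both ways.
\<close>

definition partial_acyclic_orientation :: "'a set set \<Rightarrow> ('a \<times> 'a) set \<Rightarrow> bool" where
  "partial_acyclic_orientation E D \<longleftrightarrow> (\<lambda>(u, v). {u, v}) ` D \<subseteq> E \<and> acyclic D"

definition acyclic_orientation :: "'a set set \<Rightarrow> ('a \<times> 'a) set \<Rightarrow> bool" where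
  "acyclic_orientation E D \<longleftrightarrow> (\<lambda>(u, v). {u, v}) ` D = E \<and> acyclic D"

definition game_over :: "'a set set \<Rightarrow> ('a \<times> 'a) set \<Rightarrow> bool" where
  "game_over E D \<longleftrightarrow> (\<exists>!D'. acyclic_orientation E D' \<and> D \<subseteq> D')"

text \<open>
  \<open>algy_forces E k D\<close>: from the revealed partial orientation \<open>D\<close>, Algy can make the game
  end within at most \<open>k\<close> further steps, whatever Strategist replies.  Algy may query an
  edge that is already oriented; Strategist can then only repeat the earlier answer.
\<close>

primrec algy_forces :: "'a set set \<Rightarrow> nat \<Rightarrow> ('a \<times> 'a) set \<Rightarrow> bool" where
  "algy_forces E 0 D \<longleftrightarrow> game_over E D"
| "algy_forces E (Suc k) D \<longleftrightarrow> game_over E D \<or>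
     (\<exists>u v. {u, v} \<in> E \<and>
        (\<forall>a\<in>{(u, v), (v, u)}. acyclic (insert a D) \<longrightarrow> algy_forces E k (insert a D)))"

text \<open>
  The parameter \<open>c(G)\<close>.  It depends on the edges only, since isolated vertices play no role
  in the game.  For finite \<open>E\<close> the minimum is attained, see \<open>algy_forces_game_length\<close> below.
\<close>

definition game_length :: "'a set set \<Rightarrow> nat" where
  "game_length E = (LEAST k. algy_forces E k {})"

lemma game_over_full:
  assumes "acyclic_orientation E D"
  shows "game_over E D"
  unfolding game_over_def
proof (rule ex1I[of _ D])
  show "acyclic_orientation E D \<and> D \<subseteq> D" using assms by simp
next
  fix D' assume D': "acyclic_orientation E D' \<and> D \<subseteq> D'"
  have "(u, v) \<in> D" if uv: "(u, v) \<in> D'" for u v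
  proof (rule ccontr)
    assume nin: "(u, v) \<notin> D"
    have im: "(\<lambda>(u, v). {u, v}) ` D = (\<lambda>(u, v). {u, v}) ` D'" and ac: "acyclic D'"
      using D' assms by (simp_all add: acyclic_orientation_def)
    have "{u, v} \<in> (\<lambda>(u, v). {u, v}) ` D"
      unfolding im using imageI[OF uv, of "\<lambda>(u, v). {u, v}"] by simp
    then obtain x y where "(x, y) \<in> D" "{u, v} = {x, y}" by (elim imageE) auto
    then have "(v, u) \<in> D'"
      using nin D' by (metis doubleton_eq_iff subsetD)
    with uv have "(u, u) \<in> D'\<^sup>+" by (meson trancl.intros)
    then show False using ac by (simp add: acyclic_def)
  qed
  then have "D' \<subseteq> D" by (intro subrelI)
  then show "D' = D" using D' by (intro equalityI) simp_all
qed

lemma algy_forces_unoriented: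
  assumes "simple_graph V E" "partial_acyclic_orientation E D"
    "card (E - (\<lambda>(u, v). {u, v}) ` D) \<le> k"
  shows "algy_forces E k D"
  using assms(2,3)
proof (induction k arbitrary: D)
  case 0
  have "E \<subseteq> Pow V" "finite V" using assms(1) by (auto simp: simple_graph_def)
  then have "finite E" by (meson finite_Pow_iff finite_subset)
  then have "E - (\<lambda>(u, v). {u, v}) ` D = {}" using 0(2) by simp
  then have "acyclic_orientation E D"
    using 0(1) unfolding partial_acyclic_orientation_def acyclic_orientation_def by blast
  then show ?case by (simp add: game_over_full)
next
  case (Suc k)
  have "E \<subseteq> Pow V" "finite V" using assms(1) by (auto simp: simple_graph_def)
  then have fin: "finite E" by (meson finite_Pow_iff finite_subset)
  show ?case
  proof (cases "E \<subseteq> (\<lambda>(u, v). {u, v}) ` D")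
    case True
    then have "acyclic_orientation E D"
      using Suc.prems(1) unfolding partial_acyclic_orientation_def acyclic_orientation_def
      by blast
    then show ?thesis by (simp add: game_over_full)
  next
    case False
    then obtain e where e: "e \<in> E" "e \<notin> (\<lambda>(u, v). {u, v}) ` D" by blast
    then obtain u v where uv: "e = {u, v}"
      using assms(1) by (metis simple_graph_def card_2_iff)
    have "algy_forces E k (insert a D)"
      if a: "a \<in> {(u, v), (v, u)}" "acyclic (insert a D)" for a
    proof (rule Suc.IH)
      have im: "(\<lambda>(u, v). {u, v}) ` insert a D = insert e ((\<lambda>(u, v). {u, v}) ` D)"
        using a(1) uv by (elim insertE) (simp_all add: insert_commute)
      show "partial_acyclic_orientation E (insert a D)"
        using Suc.prems(1) e(1) a(2) unfolding partial_acyclic_orientation_def im by simp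
      have "E - insert e ((\<lambda>(u, v). {u, v}) ` D) \<subset> E - (\<lambda>(u, v). {u, v}) ` D"
        using e by blast
      then have "card (E - insert e ((\<lambda>(u, v). {u, v}) ` D)) < card (E - (\<lambda>(u, v). {u, v}) ` D)"
        using fin by (intro psubset_card_mono) simp_all
      then show "card (E - (\<lambda>(u, v). {u, v}) ` insert a D) \<le> k"
        using Suc.prems(2) unfolding im by linarith
    qed
    then have "\<exists>u v. {u, v} \<in> E \<and>
        (\<forall>a\<in>{(u, v), (v, u)}. acyclic (insert a D) \<longrightarrow> algy_forces E k (insert a D))"
      using e(1) uv by blast
    then show ?thesis unfolding algy_forces.simps by (rule disjI2)
  qed
qed

lemma algy_forces_game_length:
  assumes "simple_graph V E"
  shows "algy_forces E (game_length E) {}"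
proof -
  have "algy_forces E (card E) {}"
  proof (rule algy_forces_unoriented[OF assms])
    show "partial_acyclic_orientation E {}"
      by (simp add: partial_acyclic_orientation_def acyclic_def)
  qed simp
  then show ?thesis unfolding game_length_def by (rule LeastI)
qed

end

theory Submission
  imports Defs
begin

text \<open>
  The graph is the complete tripartite graph with two parts \<open>A\<close>, \<open>B\<close> of equal size \<open>s \<ge> 1\<close>
  and a third part \<open>W\<close> of size \<open>r\<close>, where \<open>r = 1\<close> or \<open>r = 2\<close> according to the parity of
  \<open>n = 2 * s + r\<close>.

  Strategist always directs the edges between \<open>A\<close> and \<open>B\<close> from \<open>A\<close> to \<open>B\<close>.  Each \<open>w \<in> W\<close> is
  going to be a sink or a source, and Strategist decides which one only when the first edge at
  \<open>w\<close> is queried: if that edge leads to \<open>A\<close>, then \<open>w\<close> becomes a sink, and if it leads to \<open>B\<close>, then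
  \<open>w\<close> becomes a source.  In the final orientation the vertices lie on levels: the sources in \<open>W\<close>
  on level 0, \<open>A\<close> on level 1, \<open>B\<close> on level 2, the sinks in \<open>W\<close> on level 3.  Reversing one arc
  between consecutive levels never creates a cycle, so such an arc is not forced by
  all the others together and Algy has to query it (\<open>consecutive_level_arc_revealed\<close>).  These are
  the \<open>s * s\<close> arcs between \<open>A\<close> and \<open>B\<close> and \<open>s\<close> arcs at each \<open>w\<close>, namely those between \<open>w\<close>
  and \<open>B\<close> if \<open>w\<close> is a sink and those between \<open>w\<close> and \<open>A\<close> if \<open>w\<close> is a source.
  Strategist's rule makes the first edge queried at \<open>w\<close> lead to the other one of \<open>A\<close> and \<open>B\<close>, so
  it is one further query for each \<open>w\<close>.  Algy cannot leave a vertex \<open>w\<close> untouched,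
  because it could still become a sink as well as a source.  Altogether Algy
  makes at least \<open>s * s + r * s + r\<close> queries (\<open>strategist_bound\<close>), which equals
  \<open>n\<^sup>2 div 4 + 1\<close> for \<open>r \<in> {1, 2}\<close>.
\<close>

section \<open>Orientations induced by levels\<close>

definition proper_levels :: "'a set set \<Rightarrow> ('a \<Rightarrow> nat) \<Rightarrow> bool" where
  "proper_levels E h \<longleftrightarrow> (\<forall>u v. {u, v} \<in> E \<longrightarrow> h u \<noteq> h v)"

definition upward :: "'a set set \<Rightarrow> ('a \<Rightarrow> nat) \<Rightarrow> ('a \<times> 'a) set" where
  "upward E h = {(u, v). {u, v} \<in> E \<and> h u < h v}"

lemma mem_upward [simp]: "(u, v) \<in> upward E h \<longleftrightarrow> {u, v} \<in> E \<and> h u < h v"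
  by (simp add: upward_def)

lemma acyclic_upward: "acyclic (upward E h)"
proof -
  have "upward E h \<subseteq> measure h" by auto
  then show ?thesis by (meson acyclic_subset wf_acyclic wf_measure)
qed

lemma acyclic_orientation_upward:
  assumes "simple_graph V E" "proper_levels E h"
  shows "acyclic_orientation E (upward E h)"
proof -
  have "e \<in> (\<lambda>(u, v). {u, v}) ` upward E h" if e: "e \<in> E" for e
  proof -
    obtain u v where uv: "e = {u, v}"
      using assms(1) e by (metis simple_graph_def card_2_iff)
    then have "h u < h v \<or> h v < h u"
      using assms(2) e unfolding proper_levels_def by (metis nat_neq_iff)
    then have "(u, v) \<in> upward E h \<or> (v, u) \<in> upward E h"
      using e uv by (auto simp: insert_commute)
    then show ?thesis using uv by force
  qed
  then show ?thesis using acyclic_upward by (auto simp: acyclic_orientation_def)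
qed

lemma game_over_upward_eq:
  assumes "simple_graph V E" "game_over E D"
    and "proper_levels E h" "D \<subseteq> upward E h" "proper_levels E h'" "D \<subseteq> upward E h'"
  shows "upward E h = upward E h'"
  using assms acyclic_orientation_upward unfolding game_over_def by metis

text \<open>
  An arc between consecutive levels can be reversed: after stretching the levels by the factor 3
  there is room to lift the tail \<open>u\<close> just above the head \<open>v\<close>, with both of them still strictly
  between their former levels, so that no other edge at \<open>u\<close> or \<open>v\<close> changes its direction.
\<close>

lemma consecutive_level_arc_revealed:
  assumes G: "simple_graph V E" and over: "game_over E D"
    and h: "proper_levels E h" "D \<subseteq> upward E h"
    and uv: "{u, v} \<in> E" "h v = Suc (h u)"
  shows "(u, v) \<in> D"
proof (rule ccontr)
  assume nin: "(u, v) \<notin> D"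
  define h' where "h' = (\<lambda>x. if x = u then 3 * h u + 2 else if x = v then 3 * h u + 1 else 3 * h x)"
  have neq: "u \<noteq> v" using uv(2) by auto
  have mono: "h' x < h' y" if "h x < h y" "(x, y) \<noteq> (u, v)" for x y
    using that uv(2) neq by (auto simp: h'_def)
  have "h' x \<noteq> h' y" if "{x, y} \<in> E" for x y
  proof (cases "{x, y} = {u, v}")
    case True
    then show ?thesis using neq by (auto simp: h'_def doubleton_eq_iff)
  next
    case False
    then have "(x, y) \<noteq> (u, v)" "(y, x) \<noteq> (u, v)" by auto
    moreover have "h x < h y \<or> h y < h x"
      using h(1) that unfolding proper_levels_def by (metis nat_neq_iff)
    ultimately show ?thesis using mono[of x y] mono[of y x] by auto
  qed
  then have "proper_levels E h'" by (simp add: proper_levels_def)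
  moreover have "D \<subseteq> upward E h'"
  proof (rule subrelI)
    fix x y assume xy: "(x, y) \<in> D"
    then have "{x, y} \<in> E" "h x < h y" using h(2) by auto
    moreover have "(x, y) \<noteq> (u, v)" using xy nin by auto
    ultimately show "(x, y) \<in> upward E h'" using mono by simp
  qed
  ultimately have "upward E h = upward E h'"
    using game_over_upward_eq[OF G over h] by blast
  moreover have "(u, v) \<in> upward E h" using uv by simp
  ultimately have "(u, v) \<in> upward E h'" by simp
  then show False using neq by (simp add: h'_def)
qed

section \<open>The game on complete tripartite graphs\<close>

definition complete_tripartite :: "'a set \<Rightarrow> 'a set \<Rightarrow> 'a set \<Rightarrow> 'a set set" where
  "complete_tripartite A B W = (\<lambda>(u, v). {u, v}) ` (A \<times> B \<union> A \<times> W \<union> B \<times> W)"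

locale tripartite_game =
  fixes A B W :: "'a set" and s :: nat
  assumes finite_parts: "finite A" "finite B" "finite W"
    and disjoint_parts: "A \<inter> B = {}" "A \<inter> W = {}" "B \<inter> W = {}"
    and card_A: "card A = s" and card_B: "card B = s" and s_pos: "s \<ge> 1"
begin

abbreviation E :: "'a set set" where
  "E \<equiv> complete_tripartite A B W"

lemma edge_iff:
  "{u, v} \<in> E \<longleftrightarrow> (u, v) \<in> A \<times> B \<union> A \<times> W \<union> B \<times> W \<or> (v, u) \<in> A \<times> B \<union> A \<times> W \<union> B \<times> W"
  by (auto simp: complete_tripartite_def doubleton_eq_iff image_iff)

lemma simple_graph_tripartite: "simple_graph (A \<union> B \<union> W) E"
  using finite_parts disjoint_parts
  by (auto simp: simple_graph_def complete_tripartite_def card_2_iff) blast+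

definition strategist_levels :: "('a \<Rightarrow> nat) \<Rightarrow> bool" where
  "strategist_levels h \<longleftrightarrow>
     (\<forall>a\<in>A. h a = 1) \<and> (\<forall>b\<in>B. h b = 2) \<and> (\<forall>w\<in>W. h w = 0 \<or> h w = 3)"

lemma proper_strategist_levels: "strategist_levels h \<Longrightarrow> proper_levels E h"
  by (auto simp: proper_levels_def strategist_levels_def edge_iff)

lemma strategist_levels_update:
  "strategist_levels h \<Longrightarrow> w \<in> W \<Longrightarrow> i = 0 \<or> i = 3 \<Longrightarrow> strategist_levels (h(w := i))"
  using disjoint_parts by (auto simp: strategist_levels_def)

definition well_placed :: "('a \<times> 'a) set \<Rightarrow> ('a \<Rightarrow> nat) \<Rightarrow> 'a \<Rightarrow> bool" where
  "well_placed D h w \<longleftrightarrow>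
     (\<exists>a\<in>A. h w = 3 \<and> (a, w) \<in> D) \<or> (\<exists>b\<in>B. h w = 0 \<and> (w, b) \<in> D)"

text \<open>
  The positions that arise when Strategist follows the rule.  The levels \<open>h w\<close> of the
  vertices \<open>w \<in> W\<close> outside \<open>Field D\<close> are provisional: no arc at \<open>w\<close> has been revealed, and \<open>w\<close> can
  still move from level 0 to level 3 or back.
\<close>

definition strategist_position :: "('a \<times> 'a) set \<Rightarrow> ('a \<Rightarrow> nat) \<Rightarrow> bool" where
  "strategist_position D h \<longleftrightarrow> strategist_levels h \<and> D \<subseteq> upward E h \<and>
     (\<forall>w\<in>W. w \<in> Field D \<longrightarrow> well_placed D h w)"

lemma subset_upward_update:
  assumes "D \<subseteq> upward E h" "w \<notin> Field D"
  shows "D \<subseteq> upward E (h(w := i))"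
proof (rule subrelI)
  fix x y assume xy: "(x, y) \<in> D"
  then have "x \<noteq> w" "y \<noteq> w" using assms(2) by (auto simp: Field_def)
  then show "(x, y) \<in> upward E (h(w := i))" using xy assms(1) by auto
qed

lemma well_placed_mono:
  "well_placed D h w \<Longrightarrow> D \<subseteq> D' \<Longrightarrow> h' w = h w \<Longrightarrow> well_placed D' h' w"
  by (auto simp: well_placed_def)

text \<open>
  At the first query at \<open>w\<close> Strategist moves \<open>w\<close> to the level that is not next to the part
  containing the other endpoint; all other queries are answered upward.
\<close>

lemma strategist_reply:
  assumes pos: "strategist_position D h" and e: "{u, v} \<in> E"
  obtains h' arc where "arc \<in> {(u, v), (v, u)}" "strategist_position (insert arc D) h'"
proof -
  have lev: "strategist_levels h" and up: "D \<subseteq> upward E h"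
    and placed: "\<And>w. w \<in> W \<Longrightarrow> w \<in> Field D \<Longrightarrow> well_placed D h w"
    using pos by (auto simp: strategist_position_def)
  show thesis
  proof (cases "\<exists>w x. {u, v} = {w, x} \<and> w \<in> W \<and> w \<notin> Field D")
    case True
    then obtain w x where wx: "{u, v} = {w, x}" "w \<in> W" "w \<notin> Field D" by blast
    have x: "x \<in> A \<or> x \<in> B" "x \<notin> W" "x \<noteq> w"
      using e wx disjoint_parts by (auto simp: edge_iff)
    define h' where "h' = h(w := if x \<in> A then 3 else 0)"
    define arc where "arc = (if x \<in> A then (x, w) else (w, x))"
    have lev': "strategist_levels h'"
      using strategist_levels_update[OF lev wx(2)] by (simp add: h'_def)
    have "arc \<in> upward E h'"
      using x e lev' wx(1) by (auto simp: arc_def h'_def strategist_levels_def insert_commute)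
    moreover have "D \<subseteq> upward E h'"
      unfolding h'_def by (rule subset_upward_update[OF up wx(3)])
    moreover have "well_placed (insert arc D) h' z" if z: "z \<in> W" "z \<in> Field (insert arc D)" for z
    proof (cases "z = w")
      case True
      then show ?thesis using x(1) by (auto simp: well_placed_def h'_def arc_def)
    next
      case False
      then have "z \<in> Field D" using z x(2) by (auto simp: arc_def Field_def split: if_splits)
      then show ?thesis
        using False by (intro well_placed_mono[OF placed[OF z(1)]]) (auto simp: h'_def)
    qed
    ultimately have "strategist_position (insert arc D) h'"
      using lev' by (simp add: strategist_position_def)
    moreover have "arc \<in> {(u, v), (v, u)}"
      using wx(1) by (auto simp: arc_def doubleton_eq_iff)
    ultimately show thesis using that by blast
  next
    case False
    define arc where "arc = (if h u < h v then (u, v) else (v, u))"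
    have "h u \<noteq> h v"
      using proper_strategist_levels[OF lev] e by (simp add: proper_levels_def)
    then have "arc \<in> upward E h"
      using e by (auto simp: arc_def insert_commute)
    moreover have "well_placed (insert arc D) h z" if z: "z \<in> W" "z \<in> Field (insert arc D)" for z
    proof (rule well_placed_mono[OF placed[OF z(1)]])
      have "z \<in> Field D \<or> z = u \<or> z = v" using z(2) by (auto simp: arc_def Field_def split: if_splits)
      then show "z \<in> Field D" using False z(1) by (metis insert_commute)
    qed auto
    ultimately have "strategist_position (insert arc D) h"
      using lev up by (simp add: strategist_position_def)
    then show thesis using that[of arc h] by (auto simp: arc_def)
  qed
qed

lemma finite_revealed: "D \<subseteq> upward E h \<Longrightarrow> finite D"
proof (rule finite_subset)
  show "D \<subseteq> (A \<union> B \<union> W) \<times> (A \<union> B \<union> W)" if "D \<subseteq> upward E h"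
    using that by (auto simp: edge_iff dest!: subsetD)
qed (use finite_parts in simp)

text \<open>
  The \<open>s\<close> arcs at \<open>w\<close> to or from the neighbouring level are all revealed, and \<open>well_placed\<close>
  supplies one more, at the part on the far level.  An untouched \<open>w\<close> is impossible when the
  game is over, since it fits on level 0 and on level 3.
\<close>

lemma many_arcs_at_third_part:
  assumes over: "game_over E D" and pos: "strategist_position D h" and w: "w \<in> W"
  shows "s + 1 \<le> card {(x, y) \<in> D. x = w \<or> y = w}"
proof -
  let ?Q = "{(x, y) \<in> D. x = w \<or> y = w}"
  have lev: "strategist_levels h" and up: "D \<subseteq> upward E h"
    and placed: "w \<in> Field D \<Longrightarrow> well_placed D h w"
    using pos w by (auto simp: strategist_position_def)
  note proper = proper_strategist_levels
  note revealed = consecutive_level_arc_revealed[OF simple_graph_tripartite over proper[OF lev] up]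
  have finQ: "finite ?Q" using finite_revealed[OF up] by (rule rev_finite_subset) auto
  have "w \<in> Field D"
  proof (rule ccontr)
    assume nin: "w \<notin> Field D"
    have "upward E (h(w := 0)) = upward E (h(w := 3))"
      by (intro game_over_upward_eq[OF simple_graph_tripartite over] proper
          strategist_levels_update[OF lev w] subset_upward_update[OF up nin]) simp_all
    moreover obtain a where a: "a \<in> A" using card_A s_pos by fastforce
    moreover have "(w, a) \<in> upward E (h(w := 0))"
      using a w lev disjoint_parts by (auto simp: edge_iff strategist_levels_def)
    moreover have "(w, a) \<notin> upward E (h(w := 3))"
      using a w lev disjoint_parts by (auto simp: strategist_levels_def)
    ultimately show False by simp
  qed
  then consider (sink) a where "a \<in> A" "h w = 3" "(a, w) \<in> D"
    | (source) b where "b \<in> B" "h w = 0" "(w, b) \<in> D"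
    using placed by (auto simp: well_placed_def)
  then show ?thesis
  proof cases
    case sink
    have "insert (a, w) (B \<times> {w}) \<subseteq> ?Q"
      using sink revealed lev w by (auto simp: edge_iff strategist_levels_def)
    then have "card (insert (a, w) (B \<times> {w})) \<le> card ?Q" by (rule card_mono[OF finQ])
    moreover have "(a, w) \<notin> B \<times> {w}" using sink(1) disjoint_parts by auto
    ultimately show ?thesis
      using finite_parts card_B by (simp add: card_cartesian_product)
  next
    case source
    have "insert (w, b) ({w} \<times> A) \<subseteq> ?Q"
      using source revealed lev w by (auto simp: edge_iff strategist_levels_def)
    then have "card (insert (w, b) ({w} \<times> A)) \<le> card ?Q" by (rule card_mono[OF finQ])
    moreover have "(w, b) \<notin> {w} \<times> A" using source(1) disjoint_parts by auto
    ultimately show ?thesis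
      using finite_parts card_A by (simp add: card_cartesian_product)
  qed
qed

lemma game_over_card:
  assumes over: "game_over E D" and pos: "strategist_position D h"
  shows "s * s + card W * s + card W \<le> card D"
proof -
  let ?Q = "\<lambda>w. {(x, y) \<in> D. x = w \<or> y = w}"
  have lev: "strategist_levels h" and up: "D \<subseteq> upward E h"
    using pos by (auto simp: strategist_position_def)
  have finD: "finite D" by (rule finite_revealed[OF up])
  have finQ: "finite (?Q w)" for w using finD by (rule rev_finite_subset) auto
  have AB: "A \<times> B \<subseteq> D"
    using consecutive_level_arc_revealed
        [OF simple_graph_tripartite over proper_strategist_levels[OF lev] up] lev
    by (auto simp: edge_iff strategist_levels_def)
  have disj: "?Q w \<inter> ?Q w' = {}" if "w \<in> W" "w' \<in> W" "w \<noteq> w'" for w w'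
  proof -
    have "(x, y) \<notin> D" if "x \<in> W" "y \<in> W" for x y
      using that up disjoint_parts by (auto simp: edge_iff dest!: subsetD)
    then show ?thesis using that by auto
  qed
  have "s * s + card W * s + card W = card (A \<times> B) + (\<Sum>w\<in>W. s + 1)"
    using card_A card_B by (simp add: card_cartesian_product algebra_simps)
  also have "\<dots> \<le> card (A \<times> B) + (\<Sum>w\<in>W. card (?Q w))"
    using many_arcs_at_third_part[OF over pos] by (intro add_left_mono sum_mono) simp
  also have "(\<Sum>w\<in>W. card (?Q w)) = card (\<Union>w\<in>W. ?Q w)"
    using finite_parts(3) finQ disj by (subst card_UN_disjoint) auto
  also have "card (A \<times> B) + card (\<Union>w\<in>W. ?Q w) = card (A \<times> B \<union> (\<Union>w\<in>W. ?Q w))"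
    using finite_parts finQ disjoint_parts by (intro card_Un_disjoint[symmetric]) auto
  also have "\<dots> \<le> card D" using AB by (intro card_mono[OF finD]) auto
  finally show ?thesis .
qed

text \<open>
  Each query reveals at most one arc, and by \<open>strategist_reply\<close> the play can be kept among
  Strategist's positions, where the game is not over before \<open>game_over_card\<close> holds.
\<close>

lemma strategist_bound:
  assumes "algy_forces E k D" "strategist_position D h"
  shows "s * s + card W * s + card W \<le> k + card D"
  using assms
proof (induction k arbitrary: D h)
  case 0
  then show ?case using game_over_card by simp
next
  case (Suc k)
  show ?case
  proof (cases "game_over E D")
    case True
    then show ?thesis using game_over_card[OF True Suc.prems(2)] by linarith
  next
    case False
    then obtain u v where e: "{u, v} \<in> E"
      and forces: "\<And>arc. arc \<in> {(u, v), (v, u)} \<Longrightarrow> acyclic (insert arc D) \<Longrightarrow>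
        algy_forces E k (insert arc D)"
      using Suc.prems(1) by auto
    obtain h' arc where arc: "arc \<in> {(u, v), (v, u)}"
      and pos': "strategist_position (insert arc D) h'"
      using strategist_reply[OF Suc.prems(2) e] by blast
    have "insert arc D \<subseteq> upward E h'" using pos' unfolding strategist_position_def by blast
    then have "acyclic (insert arc D)" by (rule acyclic_subset[OF acyclic_upward])
    then have "s * s + card W * s + card W \<le> k + card (insert arc D)"
      using Suc.IH pos' forces[OF arc] by blast
    also have "\<dots> \<le> Suc k + card D"
      by (cases "finite D") (simp_all add: card_insert_if)
    finally show ?thesis .
  qed
qed

lemma game_length_ge: "s * s + card W * s + card W \<le> game_length E"
proof -
  let ?h = "\<lambda>x. if x \<in> A then 1 else if x \<in> B then 2 else 0 :: nat"
  have "strategist_position {} ?h"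
    using disjoint_parts by (auto simp: strategist_position_def strategist_levels_def)
  then show ?thesis
    using strategist_bound[OF algy_forces_game_length[OF simple_graph_tripartite]] by fastforce
qed

end

theorem proposition3p1:
  fixes n :: nat
  assumes "n \<ge> 3"
  shows "\<exists>(V :: nat set) (E :: nat set set).
    simple_graph V E \<and> card V = n \<and> game_length E \<ge> n\<^sup>2 div 4 + 1"
proof -
  define s where "s = (n - 1) div 2"
  define r where "r = n - 2 * s"
  have n: "n = 2 * s + r" and r: "r = 1 \<or> r = 2" and s: "s \<ge> 1"
    using assms unfolding r_def s_def by presburger+
  let ?A = "{..<s}" and ?B = "{s..<2 * s}" and ?W = "{2 * s..<n}"
  interpret tripartite_game ?A ?B ?W s
    using s by unfold_locales auto
  have "?A \<union> ?B \<union> ?W = {..<n}" using n by auto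
  then have "simple_graph {..<n} E" using simple_graph_tripartite by simp
  moreover have "n\<^sup>2 div 4 + 1 \<le> game_length E"
  proof -
    have "n\<^sup>2 = 4 * (s * s + r * s) + r * r"
      by (simp add: n power2_eq_square algebra_simps)
    then have "n\<^sup>2 div 4 + 1 = s * s + r * s + r" using r by auto
    moreover have "card ?W = r" using n by simp
    ultimately show ?thesis using game_length_ge by simp
  qed
  ultimately show ?thesis by (intro exI[of _ "{..<n}"] exI[of _ E]) simp
qed

end
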